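(* Let the split point of a triangle $T$ be its barycenter and let $T^{ct}=\{K_1,K_2,K_3\}$ be the resulting Clough--Tocher split, where $K_3$ is the subtriangle containing the longest edge of $T$. Then, as the aspect ratio $\varrho_T$ of $T$ goes to infinity, the largest angle of $K_3$ goes to $\pi$, regardless of the angles of $T$; that is, for every $\varepsilon>0$ there is $M>0$ such that for every triangle $T\subset\mathbb{R}^2$ with $\varrho_T\ge M$, the largest interior angle of $K_3$ is larger than $\pi-\varepsilon$. In particular the large angle condition is violated in $T^{ct}$: for every $\delta>0$, $K_3$ fails to satisfy $LAC(\delta)$ once $\varrho_T$ is sufficiently large.
   Context: $T\subset\mathbb{R}^2$ is a nondegenerate triangle with vertices $z_1,z_2,z_3$ and edges $e_1,e_2,e_3$, with $e_i$ opposite $z_i$, $h_i=|e_i|$, labeled so that $h_1\le h_2\le h_3$; $h_T=h_3$. $\rho_T$ is the diameter of the incircle of $T$. The aspect ratio is $\varrho_T=h_T/\rho_T=|\partial T|h_T/(4|T|)$. The barycenter is $\frac13(z_1+z_2+z_3)$. The Clough--Tocher split $T^{ct}=\{K_1,K_2,K_3\}$ of $T$ with respect to an interior split point $z_0$ consists of the three triangles obtained by connecting the vertices of $T$ to $z_0$, labeled so that $\partial K_i\cap\partial T=e_i$. A triangle satisfies $LAC(\delta)$, $\delta>0$, if all its interior angles are strictly less than $\pi-\delta$. *)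

theory Defs
  imports "HOL-Analysis.Analysis"
begin

(* A triangle is the triple (z1, z2, z3) of its vertices, so that its labelling is part of
   the data; edge e_i is the one opposite z_i. *)
type_synonym point = "real^2"
type_synonym triangle = "point \<times> point \<times> point"

fun nondegenerate :: "triangle \<Rightarrow> bool" where
  "nondegenerate (z1, z2, z3) \<longleftrightarrow> \<not> collinear {z1, z2, z3}"

fun region :: "triangle \<Rightarrow> point set" where
  "region (z1, z2, z3) = convex hull {z1, z2, z3}"

fun edge1 :: "triangle \<Rightarrow> point set" where
  "edge1 (z1, z2, z3) = closed_segment z2 z3"

fun edge2 :: "triangle \<Rightarrow> point set" where
  "edge2 (z1, z2, z3) = closed_segment z3 z1"

fun edge3 :: "triangle \<Rightarrow> point set" where
  "edge3 (z1, z2, z3) = closed_segment z1 z2"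

fun h1 :: "triangle \<Rightarrow> real" where "h1 (z1, z2, z3) = dist z2 z3"
fun h2 :: "triangle \<Rightarrow> real" where "h2 (z1, z2, z3) = dist z3 z1"
fun h3 :: "triangle \<Rightarrow> real" where "h3 (z1, z2, z3) = dist z1 z2"

(* The labelling convention; when edges have equal lengths several labellings satisfy it. *)
definition edge_ordered :: "triangle \<Rightarrow> bool" where
  "edge_ordered T \<longleftrightarrow> h1 T \<le> h2 T \<and> h2 T \<le> h3 T"

definition longest_edge_length :: "triangle \<Rightarrow> real" where
  "longest_edge_length T = Max {h1 T, h2 T, h3 T}"

(* A circle that lies in the triangle and meets an edge is tangent to that edge, since it
   cannot cross it. For a nondegenerate triangle exactly one circle meets all three. *)
definition is_incircle :: "point set \<Rightarrow> triangle \<Rightarrow> bool" where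
  "is_incircle C T \<longleftrightarrow>
     (\<exists>c r. r > 0 \<and> C = sphere c r) \<and> C \<subseteq> region T \<and>
     C \<inter> edge1 T \<noteq> {} \<and> C \<inter> edge2 T \<noteq> {} \<and> C \<inter> edge3 T \<noteq> {}"

definition incircle :: "triangle \<Rightarrow> point set" where
  "incircle T = (THE C. is_incircle C T)"

definition incircle_diameter :: "triangle \<Rightarrow> real" where
  "incircle_diameter T = diameter (incircle T)"

definition aspect_ratio :: "triangle \<Rightarrow> real" where
  "aspect_ratio T = longest_edge_length T / incircle_diameter T"

fun barycenter :: "triangle \<Rightarrow> point" where
  "barycenter (z1, z2, z3) = (1/3) *\<^sub>R (z1 + z2 + z3)"

(* The subtriangle K_i is spanned by the split point z0 and the edge e_i. *)
fun CT1 :: "point \<Rightarrow> triangle \<Rightarrow> triangle" where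
  "CT1 z0 (z1, z2, z3) = (z0, z2, z3)"

fun CT2 :: "point \<Rightarrow> triangle \<Rightarrow> triangle" where
  "CT2 z0 (z1, z2, z3) = (z0, z3, z1)"

fun CT3 :: "point \<Rightarrow> triangle \<Rightarrow> triangle" where
  "CT3 z0 (z1, z2, z3) = (z0, z1, z2)"

definition clough_tocher :: "point \<Rightarrow> triangle \<Rightarrow> triangle set" where
  "clough_tocher z0 T = {CT1 z0 T, CT2 z0 T, CT3 z0 T}"

(* Unoriented angle at the vertex b between the rays towards a and c, in [0, pi]. *)
definition angle_at :: "point \<Rightarrow> point \<Rightarrow> point \<Rightarrow> real" where
  "angle_at a b c = arccos (((a - b) \<bullet> (c - b)) / (norm (a - b) * norm (c - b)))"

fun interior_angles :: "triangle \<Rightarrow> real set" where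
  "interior_angles (z1, z2, z3) = {angle_at z2 z1 z3, angle_at z3 z2 z1, angle_at z1 z3 z2}"

definition largest_angle :: "triangle \<Rightarrow> real" where
  "largest_angle T = Max (interior_angles T)"

definition LAC :: "real \<Rightarrow> triangle \<Rightarrow> bool" where
  "LAC \<delta> T \<longleftrightarrow> (\<forall>\<theta>\<in>interior_angles T. \<theta> < pi - \<delta>)"

end

theory Submission
  imports Defs
begin

text \<open>
Let \<open>g\<close> be the barycenter, \<open>u\<close> and \<open>v\<close> the vectors from \<open>g\<close> to the endpoints of the longest edge,
\<open>h\<close> the length of that edge and \<open>d\<close> twice the area of \<open>T\<close>. The angle of \<open>K\<^sub>3\<close> that opens up is the
one at \<open>g\<close>, and it is controlled by its sine and the sign of its cosine.

The median formulas express \<open>u \<bullet> v\<close> through the edge lengths alone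
(\<open>inner_at_barycenter\<close>). As no edge is longer than \<open>h\<close>, this gives \<open>u \<bullet> v \<le> - h\<^sup>2 / 6\<close>: the angle is
always obtuse, and by Cauchy--Schwarz \<open>norm u * norm v \<ge> h\<^sup>2 / 6\<close>, so \<open>g\<close> stays away from both
endpoints on the scale of \<open>h\<close> whatever the shape of \<open>T\<close>. On the other hand \<open>K\<^sub>3\<close> has a third of the
area of \<open>T\<close>, so the sine of the angle, \<open>(d / 3) / (norm u * norm v)\<close>, is at most \<open>2 * d / h\<^sup>2\<close>.

The aspect ratio is \<open>h\<close> times the perimeter over \<open>2 * d\<close> (\<open>incircle_diameter_eq\<close>), and hence at most
\<open>3 * h\<^sup>2 / (2 * d)\<close>. If it is at least \<open>M\<close>, the sine of the angle is therefore at most \<open>3 / M\<close>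
(\<open>barycenter_angle_bounds\<close>), and an obtuse angle with a small sine is close to \<open>pi\<close>.

The diameter of the incircle is obtained from its description as the circle that lies in \<open>T\<close> and
meets every edge. In barycentric coordinates \<open>T\<close> is the set where all three coordinates are
nonnegative, and each edge is the part of \<open>T\<close> where one of them vanishes. A coordinate is an affine
function whose gradient has length \<open>edge length / d\<close>, so the condition on each edge becomes one
linear equation for the center (\<open>circle_touches_line_iff\<close>). The three equations, together with the
fact that the coordinates sum to 1, determine both the center and the radius.
\<close>

section \<open>The planar cross product\<close>

definition cross2 :: "point \<Rightarrow> point \<Rightarrow> real" where
  "cross2 u v = u $ 1 * v $ 2 - u $ 2 * v $ 1"

lemma inner_point: "(u::point) \<bullet> v = u $ 1 * v $ 1 + u $ 2 * v $ 2"
  by (simp add: inner_vec_def sum_2)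

lemma norm_point_sq: "(norm (u::point))\<^sup>2 = (u $ 1)\<^sup>2 + (u $ 2)\<^sup>2"
  unfolding power2_norm_eq_inner inner_point by (simp add: power2_eq_square)

lemma point_eq_iff: "(u::point) = v \<longleftrightarrow> u $ 1 = v $ 1 \<and> u $ 2 = v $ 2"
  by (simp add: vec_eq_iff forall_2)

lemma inner_cross2_sq: "(u \<bullet> v)\<^sup>2 + (cross2 u v)\<^sup>2 = (norm u)\<^sup>2 * (norm v)\<^sup>2"
  unfolding norm_point_sq inner_point cross2_def by (simp add: power2_eq_square algebra_simps)

lemma abs_cross2_le: "\<bar>cross2 u v\<bar> \<le> norm u * norm v"
proof (rule power2_le_imp_le)
  show "\<bar>cross2 u v\<bar>\<^sup>2 \<le> (norm u * norm v)\<^sup>2"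
    by (simp add: power_mult_distrib flip: inner_cross2_sq)
qed simp

text \<open>The maximum of \<open>cross2 v w\<close> over the circle of radius \<open>r\<close> is attained at the multiple of \<open>w\<close> turned
by a right angle.\<close>

lemma cross2_attains_bound:
  assumes "w \<noteq> 0" "0 \<le> r"
  obtains v where "norm v = r" "cross2 v w = r * norm w"
proof
  define n :: point where "n = vector [w $ 2, - w $ 1]"
  have n: "norm n = norm w"
    by (rule power2_eq_imp_eq) (simp_all add: norm_point_sq n_def)
  show "norm ((r / norm w) *\<^sub>R n) = r"
    using assms n by simp
  have "cross2 ((r / norm w) *\<^sub>R n) w = r / norm w * (norm w)\<^sup>2"
    unfolding norm_point_sq by (simp add: cross2_def n_def power2_eq_square algebra_simps)
  then show "cross2 ((r / norm w) *\<^sub>R n) w = r * norm w"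
    using assms by (simp add: power2_eq_square)
qed

text \<open>If the cross product vanishes, \<open>inner_cross2_sq\<close> turns into equality in Cauchy--Schwarz, which
characterizes parallel vectors.\<close>

lemma cross2_nonzero_if_not_collinear:
  assumes "\<not> collinear {a, b, c}"
  shows "cross2 (b - a) (c - a) \<noteq> 0"
proof
  assume "cross2 (b - a) (c - a) = 0"
  then have "\<bar>(b - a) \<bullet> (c - a)\<bar>\<^sup>2 = (norm (b - a) * norm (c - a))\<^sup>2"
    using inner_cross2_sq[of "b - a" "c - a"] by (simp add: power_mult_distrib)
  then have "\<bar>(b - a) \<bullet> (c - a)\<bar> = norm (b - a) * norm (c - a)"
    by (rule power2_eq_imp_eq) simp_all
  then have "collinear {0, b - a, c - a}"
    by (simp add: norm_cauchy_schwarz_equal)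
  then have "collinear {b, a, c}"
    by (subst collinear_3) auto
  with assms show False
    by (simp add: insert_commute)
qed

lemma cross2_edges_cyclic: "cross2 (c - b) (a - b) = cross2 (b - a) (c - a)"
  by (simp add: cross2_def algebra_simps)

section \<open>Barycentric coordinates\<close>

text \<open>The barycentric coordinate belonging to the vertex \<open>a\<close>, as the ratio of the signed areas of
\<open>(p, b, c)\<close> and \<open>(a, b, c)\<close>; the ratio does not depend on the orientation of the triangle. The
other two coordinates are obtained by permuting the vertices cyclically, which leaves the
denominator unchanged.\<close>

definition bary :: "point \<Rightarrow> point \<Rightarrow> point \<Rightarrow> point \<Rightarrow> real" where
  "bary a b c p = cross2 (b - p) (c - p) / cross2 (b - a) (c - a)"

lemma bary_add:
  "bary a b c (p + v) = bary a b c p + cross2 v (b - c) / cross2 (b - a) (c - a)"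
  unfolding bary_def add_divide_distrib[symmetric]
  by (rule arg_cong2[where f = "(/)"]) (simp_all add: cross2_def algebra_simps)

lemma bary_sum:
  assumes "cross2 (b - a) (c - a) \<noteq> 0"
  shows "bary a b c p + bary b c a p + bary c a b p = 1"
  using assms unfolding bary_def cross2_edges_cyclic[of c b a] cross2_edges_cyclic[of a c b]
  by (simp add: add_divide_distrib[symmetric]) (simp add: cross2_def algebra_simps)

lemma bary_combination:
  assumes "cross2 (b - a) (c - a) \<noteq> 0" "x + y + z = 1"
  shows "bary a b c (x *\<^sub>R a + y *\<^sub>R b + z *\<^sub>R c) = x"
proof -
  have x: "x = 1 - y - z" using assms by simp
  have "cross2 (b - (x *\<^sub>R a + y *\<^sub>R b + z *\<^sub>R c)) (c - (x *\<^sub>R a + y *\<^sub>R b + z *\<^sub>R c))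
      = x * cross2 (b - a) (c - a)"
    unfolding x by (simp add: cross2_def algebra_simps)
  then show ?thesis using assms by (simp add: bary_def)
qed

lemma bary_reconstruct:
  assumes "cross2 (b - a) (c - a) \<noteq> 0"
  shows "p = bary a b c p *\<^sub>R a + bary b c a p *\<^sub>R b + bary c a b p *\<^sub>R c"
proof -
  let ?D = "cross2 (b - a) (c - a)"
  have "?D *\<^sub>R p = cross2 (b - p) (c - p) *\<^sub>R a + cross2 (c - p) (a - p) *\<^sub>R b
      + cross2 (a - p) (b - p) *\<^sub>R c"
    unfolding point_eq_iff by (simp add: cross2_def algebra_simps)
  then have "(1 / ?D) *\<^sub>R ?D *\<^sub>R p = (1 / ?D) *\<^sub>R (cross2 (b - p) (c - p) *\<^sub>R a
      + cross2 (c - p) (a - p) *\<^sub>R b + cross2 (a - p) (b - p) *\<^sub>R c)"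
    by (rule arg_cong)
  then have "p = (1 / ?D) *\<^sub>R (cross2 (b - p) (c - p) *\<^sub>R a + cross2 (c - p) (a - p) *\<^sub>R b
      + cross2 (a - p) (b - p) *\<^sub>R c)"
    using assms by simp
  then show ?thesis
    unfolding bary_def cross2_edges_cyclic[of c b a] cross2_edges_cyclic[of a c b]
    by (simp add: scaleR_right_distrib)
qed

lemma convex_hull_bary:
  assumes "cross2 (b - a) (c - a) \<noteq> 0"
  shows "convex hull {a, b, c} = {p. 0 \<le> bary a b c p \<and> 0 \<le> bary b c a p \<and> 0 \<le> bary c a b p}"
proof -
  have D: "cross2 (c - b) (a - b) \<noteq> 0" "cross2 (a - c) (b - c) \<noteq> 0"
    using assms by (metis cross2_edges_cyclic)+
  show ?thesis
  proof (intro equalityI subsetI)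
    fix p assume "p \<in> convex hull {a, b, c}"
    then obtain x y z where xyz: "0 \<le> x" "0 \<le> y" "0 \<le> z" "x + y + z = 1"
      and p: "p = x *\<^sub>R a + y *\<^sub>R b + z *\<^sub>R c"
      unfolding convex_hull_3 by auto
    have "bary a b c p = x"
      unfolding p by (rule bary_combination) (use assms xyz in auto)
    moreover have "bary b c a (y *\<^sub>R b + z *\<^sub>R c + x *\<^sub>R a) = y"
      by (rule bary_combination) (use D xyz in auto)
    moreover have "bary c a b (z *\<^sub>R c + x *\<^sub>R a + y *\<^sub>R b) = z"
      by (rule bary_combination) (use D xyz in auto)
    ultimately show "p \<in> {p. 0 \<le> bary a b c p \<and> 0 \<le> bary b c a p \<and> 0 \<le> bary c a b p}"
      using xyz by (simp add: p add_ac)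
  next
    fix p assume "p \<in> {p. 0 \<le> bary a b c p \<and> 0 \<le> bary b c a p \<and> 0 \<le> bary c a b p}"
    then have "0 \<le> bary a b c p" "0 \<le> bary b c a p" "0 \<le> bary c a b p" by auto
    with bary_sum[OF assms, of p]
    have "bary a b c p *\<^sub>R a + bary b c a p *\<^sub>R b + bary c a b p *\<^sub>R c \<in> convex hull {a, b, c}"
      unfolding convex_hull_3 by blast
    then show "p \<in> convex hull {a, b, c}"
      using bary_reconstruct[OF assms, of p] by simp
  qed
qed

text \<open>An edge is cut out of the triangle, and not only out of a line, by the vanishing of one coordinate.
A circle inside the triangle that touches the line through an edge therefore touches the edge itself.\<close>

lemma closed_segment_bary:
  assumes "cross2 (b - a) (c - a) \<noteq> 0"
  shows "closed_segment b c = {p \<in> convex hull {a, b, c}. bary a b c p = 0}"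
proof (intro equalityI subsetI)
  fix p assume "p \<in> closed_segment b c"
  then obtain u where u: "p = (1 - u) *\<^sub>R b + u *\<^sub>R c" "0 \<le> u" "u \<le> 1"
    unfolding closed_segment_def by auto
  have "bary a b c (0 *\<^sub>R a + (1 - u) *\<^sub>R b + u *\<^sub>R c) = 0"
    by (rule bary_combination) (use assms in auto)
  moreover have "closed_segment b c \<subseteq> convex hull {a, b, c}"
    unfolding segment_convex_hull by (rule hull_mono) auto
  ultimately show "p \<in> {p \<in> convex hull {a, b, c}. bary a b c p = 0}"
    using \<open>p \<in> closed_segment b c\<close> u by auto
next
  fix p assume "p \<in> {p \<in> convex hull {a, b, c}. bary a b c p = 0}"
  then have h: "bary a b c p = 0" "0 \<le> bary b c a p" "0 \<le> bary c a b p"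
    unfolding convex_hull_bary[OF assms] by auto
  have "bary b c a p = 1 - bary c a b p"
    using bary_sum[OF assms, of p] h by simp
  then have "p = (1 - bary c a b p) *\<^sub>R b + bary c a b p *\<^sub>R c" "bary c a b p \<le> 1"
    using bary_reconstruct[OF assms, of p] h by simp_all
  then show "p \<in> closed_segment b c"
    unfolding closed_segment_def using h(3) by blast
qed

section \<open>The incircle\<close>

text \<open>Moving by \<open>r\<close> from the center \<open>x\<close> can lower the coordinate by at most \<open>r * dist b c / d\<close>, with \<open>d\<close>
twice the area, and some point of the circle attains this. So the minimum of the coordinate on the
circle is known, and the left-hand side says that this minimum is 0.\<close>

lemma circle_touches_line_iff:
  assumes D: "cross2 (b - a) (c - a) \<noteq> 0" and r: "0 < r"
  shows "(\<forall>q\<in>sphere x r. 0 \<le> bary a b c q) \<and> (\<exists>q\<in>sphere x r. bary a b c q = 0) \<longleftrightarrow>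
    bary a b c x = r * dist b c / \<bar>cross2 (b - a) (c - a)\<bar>"
proof -
  let ?D = "cross2 (b - a) (c - a)" and ?m = "r * dist b c / \<bar>cross2 (b - a) (c - a)\<bar>"
  have lower: "bary a b c x - ?m \<le> bary a b c q" if "q \<in> sphere x r" for q
  proof -
    have "norm (q - x) = r" using that by (simp add: dist_norm norm_minus_commute)
    then have "\<bar>cross2 (q - x) (b - c)\<bar> \<le> r * dist b c"
      using abs_cross2_le[of "q - x" "b - c"] by (simp add: dist_norm)
    then have "\<bar>cross2 (q - x) (b - c) / ?D\<bar> \<le> ?m"
      by (simp add: abs_divide divide_right_mono)
    moreover have "bary a b c q = bary a b c x + cross2 (q - x) (b - c) / ?D"
      using bary_add[of a b c x "q - x"] by simp
    ultimately show ?thesis by linarith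
  qed
  have "b - c \<noteq> 0" using D by (auto simp: cross2_def)
  then obtain v where v: "norm v = r" "cross2 v (b - c) = r * norm (b - c)"
    using cross2_attains_bound r by (metis less_imp_le)
  \<comment> \<open>The sign makes the coordinate decrease in either orientation of the triangle.\<close>
  define q where "q = x - sgn ?D *\<^sub>R v"
  have q: "q \<in> sphere x r"
    using v D by (simp add: q_def dist_norm sgn_if)
  have "cross2 (- sgn ?D *\<^sub>R v) (b - c) / ?D = - sgn ?D * cross2 v (b - c) / ?D"
    by (simp add: cross2_def algebra_simps)
  also have "\<dots> = - ?m"
    using D v by (simp add: dist_norm sgn_if abs_if)
  finally have bq: "bary a b c q = bary a b c x - ?m"
    using bary_add[of a b c x "- sgn ?D *\<^sub>R v"] by (simp add: q_def)
  show ?thesis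
  proof
    assume "(\<forall>q\<in>sphere x r. 0 \<le> bary a b c q) \<and> (\<exists>q\<in>sphere x r. bary a b c q = 0)"
    then show "bary a b c x = ?m"
      using lower bq q by force
  next
    assume "bary a b c x = ?m"
    then show "(\<forall>q\<in>sphere x r. 0 \<le> bary a b c q) \<and> (\<exists>q\<in>sphere x r. bary a b c q = 0)"
      using lower bq q by force
  qed
qed

lemma is_incircle_sphere_iff:
  assumes D: "cross2 (b - a) (c - a) \<noteq> 0" and r: "0 < r"
  defines "d \<equiv> \<bar>cross2 (b - a) (c - a)\<bar>"
  shows "is_incircle (sphere x r) (a, b, c) \<longleftrightarrow>
    bary a b c x = r * dist b c / d \<and> bary b c a x = r * dist c a / d \<and>
    bary c a b x = r * dist a b / d"
proof -
  have D': "cross2 (c - b) (a - b) \<noteq> 0" "cross2 (a - c) (b - c) \<noteq> 0"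
    using D by (metis cross2_edges_cyclic)+
  have d: "\<bar>cross2 (c - b) (a - b)\<bar> = d" "\<bar>cross2 (a - c) (b - c)\<bar> = d"
    unfolding d_def by (metis cross2_edges_cyclic)+
  have hull: "convex hull {b, c, a} = convex hull {a, b, c}" "convex hull {c, a, b} = convex hull {a, b, c}"
    by (simp_all add: insert_commute)
  have "\<exists>y t. 0 < t \<and> sphere x r = sphere y t"
    using r by blast
  then have "is_incircle (sphere x r) (a, b, c) \<longleftrightarrow>
      sphere x r \<subseteq> convex hull {a, b, c} \<and>
      sphere x r \<inter> {p \<in> convex hull {a, b, c}. bary a b c p = 0} \<noteq> {} \<and>
      sphere x r \<inter> {p \<in> convex hull {a, b, c}. bary b c a p = 0} \<noteq> {} \<and>
      sphere x r \<inter> {p \<in> convex hull {a, b, c}. bary c a b p = 0} \<noteq> {}"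
    unfolding is_incircle_def region.simps edge1.simps edge2.simps edge3.simps
      closed_segment_bary[OF D] closed_segment_bary[OF D'(1)] closed_segment_bary[OF D'(2)] hull
    by (simp only: simp_thms)
  also have "\<dots> \<longleftrightarrow>
      ((\<forall>q\<in>sphere x r. 0 \<le> bary a b c q) \<and> (\<exists>q\<in>sphere x r. bary a b c q = 0)) \<and>
      ((\<forall>q\<in>sphere x r. 0 \<le> bary b c a q) \<and> (\<exists>q\<in>sphere x r. bary b c a q = 0)) \<and>
      ((\<forall>q\<in>sphere x r. 0 \<le> bary c a b q) \<and> (\<exists>q\<in>sphere x r. bary c a b q = 0))"
    unfolding convex_hull_bary[OF D] by blast
  finally show ?thesis
    unfolding circle_touches_line_iff[OF D r] circle_touches_line_iff[OF D'(1) r]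
      circle_touches_line_iff[OF D'(2) r] d d_def[symmetric] .
qed

lemma diameter_sphere:
  fixes x :: "'a::euclidean_space"
  assumes "0 \<le> r"
  shows "diameter (sphere x r) = 2 * r"
proof (rule antisym)
  have "diameter (sphere x r) \<le> diameter (cball x r)"
    by (rule diameter_subset) auto
  then show "diameter (sphere x r) \<le> 2 * r"
    using assms by simp
  obtain v :: 'a where v: "norm v = r"
    using vector_choose_size assms by blast
  have "dist (x + v) (x - v) \<le> diameter (sphere x r)"
    using v by (intro diameter_bounded_bound) (auto simp: dist_norm)
  moreover have "dist (x + v) (x - v) = norm (2 *\<^sub>R v)"
    unfolding dist_norm by (simp add: scaleR_2)
  ultimately show "2 * r \<le> diameter (sphere x r)"
    using v by simp
qed

text \<open>With \<open>s\<close> the perimeter and \<open>d\<close> twice the area, the three tangency equations add up to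
\<open>1 = r * s / d\<close>, which gives the radius; the coordinates of the center are then the edge lengths
divided by \<open>s\<close>. Conversely, the point with these coordinates satisfies the equations, so the
incircle exists and is unique.\<close>

lemma incircle_diameter_eq:
  assumes D: "cross2 (b - a) (c - a) \<noteq> 0"
  shows "incircle_diameter (a, b, c) =
    2 * \<bar>cross2 (b - a) (c - a)\<bar> / (dist b c + dist c a + dist a b)"
proof -
  define d where "d = \<bar>cross2 (b - a) (c - a)\<bar>"
  define s where "s = dist b c + dist c a + dist a b"
  have D': "cross2 (c - b) (a - b) \<noteq> 0" "cross2 (a - c) (b - c) \<noteq> 0"
    using D by (metis cross2_edges_cyclic)+
  have d: "0 < d" using D by (simp add: d_def)
  have "a \<noteq> b" using D by (auto simp: cross2_def)
  then have s: "0 < s" by (simp add: s_def add_nonneg_pos)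
  define x where "x = (dist b c / s) *\<^sub>R a + (dist c a / s) *\<^sub>R b + (dist a b / s) *\<^sub>R c"
  have one: "dist b c / s + dist c a / s + dist a b / s = 1"
    using s by (simp add: s_def add_divide_distrib[symmetric])
  have "bary a b c x = dist b c / s"
    unfolding x_def by (rule bary_combination[OF D one])
  moreover have "bary b c a ((dist c a / s) *\<^sub>R b + (dist a b / s) *\<^sub>R c + (dist b c / s) *\<^sub>R a) = dist c a / s"
    by (rule bary_combination[OF D'(1)]) (use one in simp)
  moreover have "bary c a b ((dist a b / s) *\<^sub>R c + (dist b c / s) *\<^sub>R a + (dist c a / s) *\<^sub>R b) = dist a b / s"
    by (rule bary_combination[OF D'(2)]) (use one in simp)
  ultimately have x: "bary a b c x = dist b c / s" "bary b c a x = dist c a / s"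
      "bary c a b x = dist a b / s"
    by (simp_all add: x_def add_ac)
  have "is_incircle (sphere x (d / s)) (a, b, c)"
    using is_incircle_sphere_iff[OF D, of "d / s" x] d s x unfolding d_def[symmetric] by simp
  moreover have "C = sphere x (d / s)" if C: "is_incircle C (a, b, c)" for C
  proof -
    obtain y r where r: "0 < r" and C': "C = sphere y r"
      using C unfolding is_incircle_def by blast
    have y: "bary a b c y = r * dist b c / d" "bary b c a y = r * dist c a / d"
      "bary c a b y = r * dist a b / d"
      using C is_incircle_sphere_iff[OF D r, of y] unfolding C' d_def[symmetric] by auto
    have "r * s / d = 1"
      using bary_sum[OF D, of y] unfolding y s_def by (simp add: add_divide_distrib distrib_left)
    then have "r = d / s" using d s by (simp add: field_simps)
    moreover have "y = x"
      using bary_reconstruct[OF D, of y] d s unfolding y x_def \<open>r = d / s\<close> by simp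
    ultimately show ?thesis using C' by simp
  qed
  ultimately have "incircle (a, b, c) = sphere x (d / s)"
    unfolding incircle_def by (rule the_equality)
  then have "incircle_diameter (a, b, c) = 2 * (d / s)"
    unfolding incircle_diameter_def using d s by (simp only: diameter_sphere divide_nonneg_pos less_imp_le)
  then show ?thesis by (simp add: d_def s_def)
qed

section \<open>The angle at the barycenter\<close>

lemma angle_at_trig:
  assumes "u = a - b" "v = c - b" "u \<noteq> 0" "v \<noteq> 0"
  shows "cos (angle_at a b c) = u \<bullet> v / (norm u * norm v)"
    and "sin (angle_at a b c) = \<bar>cross2 u v\<bar> / (norm u * norm v)"
    and "0 \<le> angle_at a b c" "angle_at a b c \<le> pi"
proof -
  let ?q = "u \<bullet> v / (norm u * norm v)"
  have pos: "0 < norm u * norm v" using assms by simp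
  have "\<bar>?q\<bar> \<le> 1"
    using pos Cauchy_Schwarz_ineq2[of u v] by (simp add: abs_mult)
  then have q: "-1 \<le> ?q" "?q \<le> 1" by linarith+
  have ang: "angle_at a b c = arccos ?q"
    using assms by (simp add: angle_at_def)
  show "cos (angle_at a b c) = ?q" "0 \<le> angle_at a b c" "angle_at a b c \<le> pi"
    unfolding ang using q by (auto intro: arccos_lbound arccos_ubound)
  have "sin (angle_at a b c) = sqrt (1 - ?q\<^sup>2)"
    unfolding ang by (rule sin_arccos[OF q])
  also have "1 - ?q\<^sup>2 = (\<bar>cross2 u v\<bar> / (norm u * norm v))\<^sup>2"
  proof -
    have "?q\<^sup>2 + (\<bar>cross2 u v\<bar> / (norm u * norm v))\<^sup>2 = 1"
      using assms(3,4)
      by (simp add: power_divide power_mult_distrib inner_cross2_sq flip: add_divide_distrib)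
    then show ?thesis by linarith
  qed
  also have "sqrt \<dots> = \<bar>cross2 u v\<bar> / (norm u * norm v)"
    using pos by simp
  finally show "sin (angle_at a b c) = \<bar>cross2 u v\<bar> / (norm u * norm v)" .
qed

text \<open>The median formulas give \<open>9 * (norm (a - g))\<^sup>2\<close> and \<open>9 * (norm (b - g))\<^sup>2\<close> as combinations of the squared
edge lengths, and the law of cosines in the triangle \<open>(g, a, b)\<close> then gives the inner product.\<close>

lemma inner_at_barycenter:
  fixes a b c :: point
  defines "g \<equiv> barycenter (a, b, c)"
  shows "18 * ((a - g) \<bullet> (b - g)) = (dist b c)\<^sup>2 + (dist c a)\<^sup>2 - 5 * (dist a b)\<^sup>2"
  unfolding dist_norm norm_point_sq inner_point g_def
  by (simp add: power2_eq_square algebra_simps)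

lemma cross2_at_barycenter:
  fixes a b c :: point
  defines "g \<equiv> barycenter (a, b, c)"
  shows "cross2 (a - g) (b - g) = cross2 (b - a) (c - a) / 3"
  unfolding g_def cross2_def by (simp add: field_simps)

text \<open>The quantitative core: the angle at the barycenter, seen from the longest edge, is never acute, and
its sine is at most a constant over the aspect ratio, uniformly in the shape of the triangle.\<close>

lemma barycenter_angle_bounds:
  assumes T: "nondegenerate T" "edge_ordered T"
    and M: "0 < M" "M \<le> aspect_ratio T"
  obtains \<theta> where "\<theta> \<in> interior_angles (CT3 (barycenter T) T)"
    "pi / 2 \<le> \<theta>" "\<theta> \<le> pi" "sin \<theta> \<le> 3 / M"
proof -
  obtain a b c where Tabc: "T = (a, b, c)" by (metis prod_cases3)
  define g where "g = barycenter T"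
  define d where "d = \<bar>cross2 (b - a) (c - a)\<bar>"
  define h where "h = dist a b"
  have D: "cross2 (b - a) (c - a) \<noteq> 0"
    using T cross2_nonzero_if_not_collinear by (simp add: Tabc)
  have d: "0 < d" using D by (simp add: d_def)
  have h: "0 < h" using D by (auto simp: cross2_def h_def)
  have ord: "dist b c \<le> h" "dist c a \<le> h"
    using T by (auto simp: Tabc edge_ordered_def h_def)
  have "longest_edge_length T = h"
    using ord unfolding longest_edge_length_def by (intro Max_eqI) (auto simp: Tabc h_def)
  then have "aspect_ratio T = h * (dist b c + dist c a + h) / (2 * d)"
    unfolding aspect_ratio_def using incircle_diameter_eq[OF D] by (simp add: Tabc h_def d_def)
  also have "\<dots> \<le> h * (3 * h) / (2 * d)"
    using ord h d by (intro divide_right_mono mult_left_mono) auto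
  finally have "M \<le> h * (3 * h) / (2 * d)" using M by simp
  then have dM: "2 * d / h\<^sup>2 \<le> 3 / M"
    using M d h by (simp add: field_simps power2_eq_square)
  let ?u = "a - g" and ?v = "b - g"
  have "(dist b c)\<^sup>2 \<le> h\<^sup>2" "(dist c a)\<^sup>2 \<le> h\<^sup>2"
    using ord by (auto intro: power_mono)
  then have uv: "?u \<bullet> ?v \<le> - h\<^sup>2 / 6"
    using inner_at_barycenter[of a b c] unfolding g_def Tabc h_def by linarith
  have hsq: "0 < h\<^sup>2" using h by simp
  have big: "h\<^sup>2 / 6 \<le> norm ?u * norm ?v"
    using Cauchy_Schwarz_ineq2[of ?u ?v] uv by linarith
  have nz: "?u \<noteq> 0" "?v \<noteq> 0" using uv hsq by auto
  note trig = angle_at_trig[OF refl refl nz]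
  have cr: "\<bar>cross2 ?u ?v\<bar> = d / 3"
    using cross2_at_barycenter[of a b c] by (simp add: g_def Tabc d_def)
  show thesis
  proof
    show "angle_at a g b \<in> interior_angles (CT3 (barycenter T) T)"
      unfolding g_def[symmetric] by (simp add: Tabc)
    have "?u \<bullet> ?v \<le> 0" using uv hsq by linarith
    then have "cos (angle_at a g b) \<le> 0"
      unfolding trig(1) by (intro divide_nonpos_nonneg) simp_all
    then show "pi / 2 \<le> angle_at a g b"
      using trig(3) cos_gt_zero_pi[of "angle_at a g b"] by linarith
    show "angle_at a g b \<le> pi" by (rule trig(4))
    have "sin (angle_at a g b) = (d / 3) / (norm ?u * norm ?v)"
      unfolding trig(2) cr ..
    also have "\<dots> \<le> (d / 3) / (h\<^sup>2 / 6)"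
      using big hsq d nz by (intro divide_left_mono) auto
    also have "\<dots> = 2 * d / h\<^sup>2" by simp
    finally show "sin (angle_at a g b) \<le> 3 / M" using dM by linarith
  qed
qed

lemma finite_interior_angles: "finite (interior_angles T)"
  by (cases T) auto

lemma largest_angle_CT3_barycenter:
  fixes \<epsilon> :: real
  assumes "0 < \<epsilon>"
  shows "\<exists>M>0. \<forall>T. nondegenerate T \<and> edge_ordered T \<and> M \<le> aspect_ratio T \<longrightarrow>
    pi - \<epsilon> < largest_angle (CT3 (barycenter T) T)"
proof -
  \<comment> \<open>The sine is monotone only up to \<open>pi / 2\<close>.\<close>
  define e where "e = min \<epsilon> (pi / 2)"
  have e: "0 < e" "e \<le> \<epsilon>" "e \<le> pi / 2" using assms by (auto simp: e_def)
  have se: "0 < sin e" using e pi_gt_zero by (intro sin_gt_zero) linarith+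
  \<comment> \<open>Any constant above 3 works; it makes the bound \<open>3 / M\<close> on the sine strictly less than \<open>sin e\<close>.\<close>
  define M where "M = 6 / sin e"
  have M: "0 < M" "3 / M < sin e" using se by (simp_all add: M_def)
  have "pi - \<epsilon> < largest_angle (CT3 (barycenter T) T)"
    if T: "nondegenerate T" "edge_ordered T" "M \<le> aspect_ratio T" for T
  proof -
    obtain \<theta> where \<theta>: "\<theta> \<in> interior_angles (CT3 (barycenter T) T)"
      "pi / 2 \<le> \<theta>" "\<theta> \<le> pi" "sin \<theta> \<le> 3 / M"
      using barycenter_angle_bounds[OF T(1,2) M(1) T(3)] by blast
    have "pi - e < \<theta>"
    proof (rule ccontr)
      assume "\<not> pi - e < \<theta>"
      then have "sin e \<le> sin (pi - \<theta>)"
        using e \<theta> by (intro sin_monotone_2pi_le) auto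
      then show False using \<theta> M by simp
    qed
    also have "\<theta> \<le> largest_angle (CT3 (barycenter T) T)"
      unfolding largest_angle_def using \<theta>(1) finite_interior_angles by (rule Max_ge[rotated])
    finally show ?thesis using e by linarith
  qed
  with M show ?thesis by blast
qed

lemma not_LAC_if_largest_angle:
  assumes "pi - \<delta> < largest_angle K"
  shows "\<not> LAC \<delta> K"
proof -
  have "interior_angles K \<noteq> {}" by (cases K) auto
  then have "largest_angle K \<in> interior_angles K"
    unfolding largest_angle_def by (intro Max_in finite_interior_angles)
  with assms show ?thesis unfolding LAC_def by force
qed

theorem lemma2p4:
  shows "(\<forall>\<epsilon>>0. \<exists>M>0. \<forall>T :: triangle.
            nondegenerate T \<and> edge_ordered T \<and> aspect_ratio T \<ge> M \<longrightarrow>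
            largest_angle (CT3 (barycenter T) T) > pi - \<epsilon>) \<and>
         (\<forall>\<delta>>0. \<exists>M>0. \<forall>T :: triangle.
            nondegenerate T \<and> edge_ordered T \<and> aspect_ratio T \<ge> M \<longrightarrow>
            \<not> LAC \<delta> (CT3 (barycenter T) T) \<and>
            \<not> (\<forall>K\<in>clough_tocher (barycenter T) T. LAC \<delta> K))"
proof (rule conjI)
  show "\<forall>\<epsilon>>0. \<exists>M>0. \<forall>T :: triangle.
      nondegenerate T \<and> edge_ordered T \<and> aspect_ratio T \<ge> M \<longrightarrow>
      largest_angle (CT3 (barycenter T) T) > pi - \<epsilon>"
    using largest_angle_CT3_barycenter by blast
  have "CT3 (barycenter T) T \<in> clough_tocher (barycenter T) T" for T
    by (simp add: clough_tocher_def)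
  then show "\<forall>\<delta>>0. \<exists>M>0. \<forall>T :: triangle.
      nondegenerate T \<and> edge_ordered T \<and> aspect_ratio T \<ge> M \<longrightarrow>
      \<not> LAC \<delta> (CT3 (barycenter T) T) \<and>
      \<not> (\<forall>K\<in>clough_tocher (barycenter T) T. LAC \<delta> K)"
    using largest_angle_CT3_barycenter not_LAC_if_largest_angle by meson
qed

end
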